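(* Let $n\ge 1$ and let $\beta\in B_n$ be a braid on $n$ strands. Then $\|\beta\|_\ell=\|\beta^{-1}\|_d$, i.e. the laminated norm of $\beta$ is equal to the diagrammatic norm of $\beta^{-1}$.
   Context: Let $D^2\subseteq\mathbb{C}$ be the closed unit disk, let $p_1<\dots<p_n$ be points of $(-1,1)$ (the punctures), and let $P_n=\{p_1,\dots,p_n\}$. Let $H_n$ be the group of orientation-preserving homeomorphisms $h:\mathbb{C}\to\mathbb{C}$ such that $h(P_n)=P_n$, $h(\partial D^2)=\partial D^2$, $h(1)=1$ and $h(-1)=-1$. The braid group $B_n$ is the quotient of $H_n$ by the isotopy relation (isotopy through elements of $H_n$). The trivial lamination $\mathbf{L}$ is the union of the vertical lines $\frac12(p_j+p_{j+1})+i\mathbb{R}$, $1\le j\le n-1$. For $\beta\in B_n$, the laminated norm is $\|\beta\|_\ell:=\min\{|h(\mathbf{L})\cap[-1,1]| : h\in H_n\text{ represents }\beta\}$ and the diagrammatic norm is $\|\beta\|_d:=\min\{|h([-1,1])\cap\mathbf{L}| : h\in H_n \text{ represents }\beta\}$. *)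

theory Defs
  imports "HOL-Complex_Analysis.Complex_Analysis" "HOL-Algebra.Group"
begin

text \<open>Only the values \<open>p 1, \<dots>, p n\<close> of the sequence of punctures are ever used.\<close>

definition punctures :: "nat \<Rightarrow> (nat \<Rightarrow> real) \<Rightarrow> complex set" where
  "punctures n p = (\<lambda>j. complex_of_real (p j)) ` {1..n}"

text \<open>Orientation is expressed through the local degree: every positively oriented circle around
  \<open>z\<close> is mapped to a loop that winds once, counterclockwise, around \<open>h z\<close>.
  The winding number of the library is defined for all continuous paths.\<close>

definition orientation_preserving :: "(complex \<Rightarrow> complex) \<Rightarrow> bool" where
  "orientation_preserving h \<longleftrightarrow> (\<forall>z. \<forall>r>0. winding_number (h \<circ> circlepath z r) (h z) = 1)"

definition braid_homeos :: "nat \<Rightarrow> (nat \<Rightarrow> real) \<Rightarrow> (complex \<Rightarrow> complex) set" where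
  "braid_homeos n p =
     {h. (\<exists>k. homeomorphism UNIV UNIV h k) \<and> orientation_preserving h \<and>
         h ` punctures n p = punctures n p \<and> h ` sphere 0 1 = sphere 0 1 \<and>
         h 1 = 1 \<and> h (-1) = -1}"

text \<open>A homotopy all of whose stages lie in \<^term>\<open>braid_homeos n p\<close> is an isotopy through
  elements of that group.\<close>

definition isotopy_rel :: "nat \<Rightarrow> (nat \<Rightarrow> real) \<Rightarrow> ((complex \<Rightarrow> complex) \<times> (complex \<Rightarrow> complex)) set" where
  "isotopy_rel n p =
     {(f, g). f \<in> braid_homeos n p \<and> g \<in> braid_homeos n p \<and>
              homotopic_with_canon (\<lambda>h. h \<in> braid_homeos n p) UNIV UNIV f g}"

definition braid_group :: "nat \<Rightarrow> (nat \<Rightarrow> real) \<Rightarrow> (complex \<Rightarrow> complex) set monoid" where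
  "braid_group n p =
     \<lparr>carrier = braid_homeos n p // isotopy_rel n p,
      mult = (\<lambda>A B. \<Union>f\<in>A. \<Union>g\<in>B. isotopy_rel n p `` {f \<circ> g}),
      one = isotopy_rel n p `` {id}\<rparr>"

definition trivial_lamination :: "nat \<Rightarrow> (nat \<Rightarrow> real) \<Rightarrow> complex set" where
  "trivial_lamination n p = (\<Union>j\<in>{1..n-1}. {z. Re z = (p j + p (j + 1)) / 2})"

text \<open>Individual representatives of a braid may produce infinitely many intersection points, whereas
  \<^const>\<open>card\<close> is \<open>0\<close> on infinite sets; intersection points are therefore counted in \<^typ>\<open>enat\<close>.
  As \<^typ>\<open>enat\<close> is well-ordered, the infima below, over nonempty classes, are minima.\<close>

definition ecard :: "'a set \<Rightarrow> enat" where
  "ecard A = (if finite A then enat (card A) else \<infinity>)"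

definition laminated_norm :: "nat \<Rightarrow> (nat \<Rightarrow> real) \<Rightarrow> (complex \<Rightarrow> complex) set \<Rightarrow> enat" where
  "laminated_norm n p \<beta> =
     (INF h\<in>\<beta>. ecard (h ` trivial_lamination n p \<inter> closed_segment (-1) 1))"

definition diagrammatic_norm :: "nat \<Rightarrow> (nat \<Rightarrow> real) \<Rightarrow> (complex \<Rightarrow> complex) set \<Rightarrow> enat" where
  "diagrammatic_norm n p \<beta> =
     (INF h\<in>\<beta>. ecard (h ` closed_segment (-1) 1 \<inter> trivial_lamination n p))"

end

theory Submission
  imports Defs
begin

text \<open>A representative \<open>h\<close> of \<open>\<beta>\<close> maps \<open>L \<inter> h\<^sup>-\<^sup>1([-1,1])\<close> bijectively onto \<open>h(L) \<inter> [-1,1]\<close>, so it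
  suffices that the representatives of \<open>\<beta>\<^sup>-\<^sup>1\<close> are exactly the inverses of those of \<open>\<beta>\<close>. The
  topological input is that the homeomorphisms in question form a group, in particular that inverses
  preserve orientation: a homeomorphism of degree \<open>1\<close> on circles around \<open>z\<close> preserves the winding
  number of every loop around \<open>z\<close>, since such a loop is homotopic to an iterated circle.\<close>

text \<open>The prefix \<open>inv\<close> is taken by the inverse of \<^theory>\<open>HOL-Algebra.Group\<close>.\<close>

abbreviation inverse_map :: "('a \<Rightarrow> 'b) \<Rightarrow> 'b \<Rightarrow> 'a" where
  "inverse_map f \<equiv> inv_into UNIV f"

section \<open>Winding numbers under orientation-preserving homeomorphisms\<close>

text \<open>The unit circle around \<open>z\<close> traversed \<open>m\<close> times, clockwise for
  negative \<open>m\<close>. The integer power exhibits it as the standard circle followed by the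
  power map \<open>u powi m\<close>.\<close>

definition iterated_circle :: "int \<Rightarrow> complex \<Rightarrow> real \<Rightarrow> complex" where
  "iterated_circle m z t = z + exp (2 * of_real pi * of_real t * \<i>) powi m"

lemma iterated_circle_exp:
  "iterated_circle m z = (\<lambda>t. z + exp (2 * of_real pi * \<i> * of_int m * of_real t))"
  by (auto simp: iterated_circle_def exp_power_int algebra_simps)

lemma
  shows path_iterated_circle: "path (iterated_circle m z)"
    and iterated_circle_loop: "pathfinish (iterated_circle m z) = pathstart (iterated_circle m z)"
    and path_image_iterated_circle: "z \<notin> path_image (iterated_circle m z)"
proof -
  show "path (iterated_circle m z)"
    unfolding path_def iterated_circle_exp by (intro continuous_intros)
  have "exp (2 * of_real pi * \<i> * of_int m) = (1::complex)"
    using exp_integer_2pi[OF Ints_of_int[of m]] by (simp add: mult_ac)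
  then show "pathfinish (iterated_circle m z) = pathstart (iterated_circle m z)"
    by (simp add: iterated_circle_exp pathfinish_def pathstart_def)
  show "z \<notin> path_image (iterated_circle m z)"
    by (auto simp: path_image_def iterated_circle_exp)
qed

lemma winding_number_iterated_circle: "winding_number (iterated_circle m z) z = of_int m"
proof -
  let ?c = "2 * of_real pi * \<i> * of_int m :: complex"
  have deriv: "(iterated_circle m z has_vector_derivative ?c * exp (?c * of_real t)) (at t within A)"
    for t A
    unfolding iterated_circle_exp
    by (auto intro!: derivative_eq_intros has_vector_derivative_real_field simp: mult.commute)
  have "iterated_circle m z C1_differentiable_on {0..1}"
    unfolding C1_differentiable_on_def
    by (intro exI[of _ "\<lambda>t. ?c * exp (?c * of_real t)"] conjI ballI deriv continuous_intros)
  then have valid: "valid_path (iterated_circle m z)"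
    by (simp add: valid_path_def C1_differentiable_imp_piecewise)
  have "((\<lambda>w. 1 / (w - z)) has_contour_integral ?c) (iterated_circle m z)"
  proof -
    \<comment> \<open>The factor \<open>1 / (w - z)\<close> cancels the exponential in the
      derivative, so the integrand is the constant \<open>?c\<close>.\<close>
    have "vector_derivative (iterated_circle m z) (at t within {0..1}) = ?c * exp (?c * of_real t)"
      if "t \<in> {0..1}" for t
      using that by (intro vector_derivative_within_cbox[of 0 1, simplified] deriv) auto
    then have "1 / (iterated_circle m z t - z) * vector_derivative (iterated_circle m z) (at t within {0..1}) = ?c"
      if "t \<in> {0..1}" for t
      using that by (simp add: iterated_circle_exp)
    moreover have "((\<lambda>t. ?c) has_integral ?c) {0..1::real}"
      using has_integral_const_real[of ?c 0 1] by simp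
    ultimately show ?thesis
      unfolding has_contour_integral_def by (subst has_integral_cong) auto
  qed
  then show ?thesis
    using winding_number_valid_path[OF valid path_image_iterated_circle]
    by (simp add: contour_integral_unique)
qed

lemma homotopic_loops_continuous_image_Compl:
  assumes "homotopic_loops (-{z}) p q" "continuous_on UNIV h" "inj h"
  shows "homotopic_loops (-{h z}) (h \<circ> p) (h \<circ> q)"
proof (rule homotopic_loops_continuous_image[OF assms(1)])
  show "continuous_on (-{z}) h"
    using assms(2) continuous_on_subset by blast
  show "h \<in> -{z} \<rightarrow> -{h z}"
    using assms(3) by (auto dest: injD)
qed

text \<open>Degree 1 makes the image of the unit circle homotopic to the unit circle around
  \<open>h z\<close> in the punctured plane. Precomposing this homotopy with the \<open>m\<close>-th
  power map of the circle gives the claim for \<open>m\<close> turns.\<close>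

lemma winding_number_homeo_iterated_circle:
  assumes h: "continuous_on UNIV h" "inj h"
    and deg: "winding_number (h \<circ> circlepath z 1) (h z) = 1"
  shows "winding_number (h \<circ> iterated_circle m z) (h z) = of_int m"
proof -
  have path: "path (h \<circ> circlepath z 1)"
    by (meson h(1) continuous_on_subset path_continuous_image path_circlepath top_greatest)
  have avoid: "h z \<notin> path_image (h \<circ> circlepath z 1)"
    using h(2) by (auto simp: path_image_compose inj_image_mem_iff)
  have "homotopic_loops (-{h z}) (h \<circ> circlepath z 1) (circlepath (h z) 1)"
    using path avoid
    by (subst winding_number_homotopic_loops_eq[symmetric])
       (auto simp: deg winding_number_circlepath pathfinish_compose pathstart_compose)
  \<comment> \<open>The power map acts on the circle itself, so loops are first turned into maps on
    \<open>sphere 0 1\<close>; \<open>Arg2pi u / (2 * pi)\<close> recovers the parameter of the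
    point \<open>u\<close>.\<close>
  then have "homotopic_with_canon (\<lambda>f. True) (sphere 0 1) (-{h z})
      (h \<circ> circlepath z 1 \<circ> (\<lambda>u. Arg2pi u / (2 * pi))) (circlepath (h z) 1 \<circ> (\<lambda>u. Arg2pi u / (2 * pi)))"
    by (rule homotopic_loops_imp_homotopic_circlemaps)
  moreover have arg: "exp (\<i> * of_real (Arg2pi u)) = u" if "cmod u = 1" for u
    using Arg2pi_eq[of u] that by simp
  ultimately have "homotopic_with_canon (\<lambda>f. True) (sphere 0 1) (-{h z})
      (\<lambda>u. h (z + u)) (\<lambda>u. h z + u)"
    by (elim homotopic_with_eq) (auto simp: circlepath mult_ac arg)
  moreover have "continuous_map (top_of_set (sphere 0 1)) (top_of_set (sphere 0 1)) (\<lambda>u::complex. u powi m)"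
    by (auto intro!: continuous_intros simp: norm_power_int)
  ultimately have "homotopic_with_canon (\<lambda>f. True) (sphere 0 1) (-{h z})
      ((\<lambda>u. h (z + u)) \<circ> (\<lambda>u. u powi m)) ((\<lambda>u. h z + u) \<circ> (\<lambda>u. u powi m))"
    by (rule homotopic_with_compose_continuous_map_right) auto
  \<comment> \<open>Composing with the exponential parametrization turns the circle maps back into
    loops.\<close>
  then have "homotopic_loops (-{h z}) (h \<circ> iterated_circle m z) (iterated_circle m (h z))"
    by (drule_tac homotopic_circlemaps_imp_homotopic_loops) (simp add: iterated_circle_def[abs_def] o_def)
  then show ?thesis
    using winding_number_homotopic_loops winding_number_iterated_circle by metis
qed

text \<open>Loops in the plane punctured at \<open>z\<close> are classified up to homotopy by their
  winding number, so \<open>\<gamma>\<close> may be replaced by the iterated circle with the same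
  number.\<close>

lemma winding_number_homeo_loop:
  assumes h: "continuous_on UNIV h" "inj h"
    and deg: "winding_number (h \<circ> circlepath z 1) (h z) = 1"
    and \<gamma>: "path \<gamma>" "pathfinish \<gamma> = pathstart \<gamma>" "z \<notin> path_image \<gamma>"
  shows "winding_number (h \<circ> \<gamma>) (h z) = winding_number \<gamma> z"
proof -
  obtain m where m: "winding_number \<gamma> z = of_int m"
    using integer_winding_number[OF \<gamma>] by (auto elim: Ints_cases)
  have "homotopic_loops (-{z}) \<gamma> (iterated_circle m z)"
    using \<gamma> m
    by (subst winding_number_homotopic_loops_eq[symmetric])
       (auto simp: path_iterated_circle iterated_circle_loop path_image_iterated_circle
          winding_number_iterated_circle)
  then have "winding_number (h \<circ> \<gamma>) (h z) = winding_number (h \<circ> iterated_circle m z) (h z)"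
    by (intro winding_number_homotopic_loops homotopic_loops_continuous_image_Compl h)
  then show ?thesis
    by (simp add: m winding_number_homeo_iterated_circle[OF h deg])
qed

section \<open>The group of representatives\<close>

context
  fixes n :: nat and p :: "nat \<Rightarrow> real"
begin

lemma braid_homeosD:
  assumes "h \<in> braid_homeos n p"
  shows "continuous_on UNIV h" "inj h" "bij h" "continuous_on UNIV (inverse_map h)"
    "homeomorphism UNIV UNIV h (inverse_map h)"
proof -
  obtain k where k: "homeomorphism UNIV UNIV h k"
    using assms by (auto simp: braid_homeos_def)
  then have "h \<circ> k = id" "k \<circ> h = id"
    by (auto simp: homeomorphism_def)
  then have "inverse_map h = k" "bij h"
    by (auto simp: inv_unique_comp o_bij)
  then show "continuous_on UNIV h" "inj h" "bij h" "continuous_on UNIV (inverse_map h)"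
    "homeomorphism UNIV UNIV h (inverse_map h)"
    using k by (auto simp: homeomorphism_def bij_is_inj)
qed

lemma id_in_braid_homeos: "id \<in> braid_homeos n p"
proof -
  have "homeomorphism UNIV UNIV id (id :: complex \<Rightarrow> complex)"
    by (auto simp: homeomorphism_def)
  then show ?thesis
    by (auto simp: braid_homeos_def orientation_preserving_def winding_number_circlepath)
qed

text \<open>The definition of orientation controls only round circles. Composites and inverses
  produce images of circles, which need not be round, hence the extension to all loops.\<close>

lemma winding_number_braid_homeo:
  assumes "h \<in> braid_homeos n p" "path \<gamma>" "pathfinish \<gamma> = pathstart \<gamma>" "z \<notin> path_image \<gamma>"
  shows "winding_number (h \<circ> \<gamma>) (h z) = winding_number \<gamma> z"
  using assms braid_homeosD[OF assms(1)]
  by (intro winding_number_homeo_loop) (auto simp: braid_homeos_def orientation_preserving_def)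

lemma comp_in_braid_homeos:
  assumes f: "f \<in> braid_homeos n p" and g: "g \<in> braid_homeos n p"
  shows "f \<circ> g \<in> braid_homeos n p"
proof -
  have "homeomorphism UNIV UNIV (f \<circ> g) (inverse_map g \<circ> inverse_map f)"
    using homeomorphism_compose braid_homeosD(5)[OF f] braid_homeosD(5)[OF g] by blast
  moreover have "orientation_preserving (f \<circ> g)"
    unfolding orientation_preserving_def
  proof (intro allI impI)
    fix z :: complex and r :: real
    assume "r > 0"
    have "path (g \<circ> circlepath z r)"
      by (meson braid_homeosD(1)[OF g] continuous_on_subset path_continuous_image path_circlepath top_greatest)
    moreover have "g z \<notin> path_image (g \<circ> circlepath z r)"
      using braid_homeosD(2)[OF g] \<open>r > 0\<close> by (auto simp: path_image_compose inj_image_mem_iff)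
    ultimately have "winding_number (f \<circ> (g \<circ> circlepath z r)) (f (g z)) = winding_number (g \<circ> circlepath z r) (g z)"
      by (intro winding_number_braid_homeo f) (auto simp: pathfinish_compose pathstart_compose)
    also have "\<dots> = 1"
      using g \<open>r > 0\<close> by (auto simp: braid_homeos_def orientation_preserving_def)
    finally show "winding_number (f \<circ> g \<circ> circlepath z r) ((f \<circ> g) z) = 1"
      by (simp add: o_assoc)
  qed
  ultimately show ?thesis
    using f g unfolding braid_homeos_def mem_Collect_eq image_comp[symmetric] o_apply by metis
qed

lemma inv_in_braid_homeos:
  assumes h: "h \<in> braid_homeos n p"
  shows "inverse_map h \<in> braid_homeos n p"
proof -
  note hD = braid_homeosD[OF h]
  have inv: "h (inverse_map h x) = x" "inverse_map h (h x) = x" for x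
    using hD(3) by (auto simp: bij_is_surj bij_is_inj surj_f_inv_f)
  have image: "inverse_map h ` A = A" if "h ` A = A" for A
    using that hD(2) by (metis image_inv_f_f)
  have "orientation_preserving (inverse_map h)"
    unfolding orientation_preserving_def
  proof (intro allI impI)
    fix z :: complex and r :: real
    assume "r > 0"
    have "path (inverse_map h \<circ> circlepath z r)"
      by (meson hD(4) continuous_on_subset path_continuous_image path_circlepath top_greatest)
    moreover have "inverse_map h z \<notin> path_image (inverse_map h \<circ> circlepath z r)"
      using bij_imp_bij_inv[OF hD(3)] \<open>r > 0\<close>
      by (auto simp: path_image_compose bij_is_inj inj_image_mem_iff)
    \<comment> \<open>Invariance is applied to \<open>h\<close>, not to its inverse:
      \<open>h\<close> carries the loop with unknown winding number back to a circle.\<close>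
    ultimately have "winding_number (inverse_map h \<circ> circlepath z r) (inverse_map h z)
        = winding_number (h \<circ> (inverse_map h \<circ> circlepath z r)) (h (inverse_map h z))"
      by (intro winding_number_braid_homeo[symmetric] h) (auto simp: pathfinish_compose pathstart_compose)
    also have "h \<circ> (inverse_map h \<circ> circlepath z r) = circlepath z r"
      by (auto simp: inv)
    finally show "winding_number (inverse_map h \<circ> circlepath z r) (inverse_map h z) = 1"
      using \<open>r > 0\<close> by (simp add: inv winding_number_circlepath del: o_apply)
  qed
  moreover have "inverse_map h 1 = 1" "inverse_map h (-1) = -1"
    using h inv(2)[of 1] inv(2)[of "-1"] by (auto simp: braid_homeos_def)
  ultimately show ?thesis
    using h hD(5) image homeomorphism_symD unfolding braid_homeos_def mem_Collect_eq by metis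
qed

section \<open>Isotopy as a congruence on the representatives\<close>

lemma equiv_isotopy_rel: "equiv (braid_homeos n p) (isotopy_rel n p)"
proof (rule equivI)
  show "isotopy_rel n p \<subseteq> braid_homeos n p \<times> braid_homeos n p"
    by (auto simp: isotopy_rel_def)
  show "refl_on (braid_homeos n p) (isotopy_rel n p)"
    by (auto simp: refl_on_def isotopy_rel_def braid_homeosD)
  show "sym (isotopy_rel n p)"
    by (auto simp: sym_def isotopy_rel_def intro: homotopic_with_symD)
  show "trans (isotopy_rel n p)"
    by (auto simp: trans_def isotopy_rel_def intro: homotopic_with_trans)
qed

lemma isotopy_rel_comp_left:
  assumes "f \<in> braid_homeos n p" "(g, g') \<in> isotopy_rel n p"
  shows "(f \<circ> g, f \<circ> g') \<in> isotopy_rel n p"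
proof -
  have "homotopic_with_canon (\<lambda>h. h \<in> braid_homeos n p) UNIV UNIV (f \<circ> g) (f \<circ> g')"
    using assms braid_homeosD(1)[OF assms(1)]
    \<comment> \<open>The instantiated \<open>p\<close> is the rule's predicate on the stages of the
      given homotopy, not the sequence of punctures.\<close>
    by (intro homotopic_with_compose_continuous_map_left[where p = "\<lambda>h. h \<in> braid_homeos n p"])
       (auto simp: isotopy_rel_def comp_in_braid_homeos)
  then show ?thesis
    using assms by (auto simp: isotopy_rel_def comp_in_braid_homeos)
qed

lemma isotopy_rel_comp_right:
  assumes "g \<in> braid_homeos n p" "(f, f') \<in> isotopy_rel n p"
  shows "(f \<circ> g, f' \<circ> g) \<in> isotopy_rel n p"
proof -
  have "homotopic_with_canon (\<lambda>h. h \<in> braid_homeos n p) UNIV UNIV (f \<circ> g) (f' \<circ> g)"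
    using assms braid_homeosD(1)[OF assms(1)]
    by (intro homotopic_with_compose_continuous_map_right[where p = "\<lambda>h. h \<in> braid_homeos n p"])
       (auto simp: isotopy_rel_def comp_in_braid_homeos)
  then show ?thesis
    using assms by (auto simp: isotopy_rel_def comp_in_braid_homeos)
qed

text \<open>Composing an isotopy \<open>H\<^sub>t\<close> from \<open>f\<close> to \<open>g\<close> as \<open>f\<^sup>-\<^sup>1 \<circ> H\<^sub>t \<circ> g\<^sup>-\<^sup>1\<close> avoids proving that
  \<open>H\<^sub>t\<^sup>-\<^sup>1\<close> depends continuously on \<open>t\<close>.\<close>

lemma isotopy_rel_inv:
  assumes "(f, g) \<in> isotopy_rel n p"
  shows "(inverse_map f, inverse_map g) \<in> isotopy_rel n p"
proof -
  have fg: "f \<in> braid_homeos n p" "g \<in> braid_homeos n p"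
    using assms by (auto simp: isotopy_rel_def)
  have "(inverse_map f \<circ> (f \<circ> inverse_map g), inverse_map f \<circ> (g \<circ> inverse_map g)) \<in> isotopy_rel n p"
    by (intro isotopy_rel_comp_left isotopy_rel_comp_right inv_in_braid_homeos fg assms)
  moreover have "inverse_map f \<circ> (f \<circ> inverse_map g) = inverse_map g" "g \<circ> inverse_map g = id"
    using braid_homeosD(3)[OF fg(1)] braid_homeosD(3)[OF fg(2)]
    by (auto simp: fun_eq_iff bij_is_surj bij_is_inj surj_f_inv_f)
  ultimately show ?thesis
    using equiv_isotopy_rel by (auto simp: equiv_def dest: symD)
qed

section \<open>The braid group and its inversion\<close>

lemma mult_braid_group:
  assumes "f \<in> braid_homeos n p" "g \<in> braid_homeos n p"
  shows "isotopy_rel n p `` {f} \<otimes>\<^bsub>braid_group n p\<^esub> isotopy_rel n p `` {g} = isotopy_rel n p `` {f \<circ> g}"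
proof -
  \<comment> \<open>The product is a union over all pairs of representatives; by congruence every
    pair contributes the same class.\<close>
  have "congruent2 (isotopy_rel n p) (isotopy_rel n p) (\<lambda>f g. isotopy_rel n p `` {f \<circ> g})"
    by (intro congruent2I[OF equiv_isotopy_rel equiv_isotopy_rel] equiv_class_eq[OF equiv_isotopy_rel]
        isotopy_rel_comp_left isotopy_rel_comp_right)
  then show ?thesis
    using UN_equiv_class2[OF equiv_isotopy_rel equiv_isotopy_rel _ assms] by (simp add: braid_group_def)
qed

lemma carrier_braid_group: "carrier (braid_group n p) = (\<lambda>h. isotopy_rel n p `` {h}) ` braid_homeos n p"
  by (auto simp: braid_group_def quotient_def)

lemma one_braid_group: "\<one>\<^bsub>braid_group n p\<^esub> = isotopy_rel n p `` {id}"
  by (simp add: braid_group_def)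

lemma inv_comp_braid_homeo: "h \<in> braid_homeos n p \<Longrightarrow> inverse_map h \<circ> h = id"
  by (simp add: braid_homeosD)

lemma group_braid_group: "group (braid_group n p)"
proof (rule groupI)
  fix x assume "x \<in> carrier (braid_group n p)"
  then obtain h where h: "h \<in> braid_homeos n p" "x = isotopy_rel n p `` {h}"
    by (auto simp: carrier_braid_group)
  then show "\<exists>y\<in>carrier (braid_group n p). y \<otimes>\<^bsub>braid_group n p\<^esub> x = \<one>\<^bsub>braid_group n p\<^esub>"
    by (intro bexI[of _ "isotopy_rel n p `` {inverse_map h}"])
       (auto simp: carrier_braid_group one_braid_group mult_braid_group inv_in_braid_homeos inv_comp_braid_homeo)
qed (auto simp: carrier_braid_group one_braid_group mult_braid_group comp_in_braid_homeos
      id_in_braid_homeos o_assoc)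

lemma inv_isotopy_class:
  assumes h: "h \<in> braid_homeos n p"
  shows "inv\<^bsub>braid_group n p\<^esub> (isotopy_rel n p `` {h}) = isotopy_rel n p `` {inverse_map h}"
  using h by (intro group.inv_equality[OF group_braid_group])
    (auto simp: carrier_braid_group one_braid_group mult_braid_group inv_in_braid_homeos inv_comp_braid_homeo)

text \<open>The norms are infima over representatives, so the group inverse is needed as a set of
  maps.\<close>

lemma inv_braid_group:
  assumes "\<beta> \<in> carrier (braid_group n p)"
  shows "inv\<^bsub>braid_group n p\<^esub> \<beta> = inverse_map ` \<beta>"
proof -
  obtain h where h: "h \<in> braid_homeos n p" and \<beta>: "\<beta> = isotopy_rel n p `` {h}"
    using assms by (auto simp: carrier_braid_group)
  \<comment> \<open>For the inclusion not given directly by \<open>isotopy_rel_inv\<close>: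
    \<open>k\<close> is the inverse of \<open>inverse_map k\<close>, which is isotopic to
    \<open>h\<close>.\<close>
  have "k \<in> inverse_map ` \<beta>" if "(inverse_map h, k) \<in> isotopy_rel n p" for k
  proof -
    have "inverse_map (inverse_map k) = k" "inverse_map (inverse_map h) = h"
      using that h by (auto simp: isotopy_rel_def braid_homeosD inv_inv_eq)
    then show ?thesis
      using isotopy_rel_inv[OF that] by (auto simp: \<beta> intro: rev_image_eqI)
  qed
  then show ?thesis
    by (auto simp: \<beta> inv_isotopy_class[OF h] isotopy_rel_inv)
qed

end

section \<open>Comparison of the norms\<close>

lemma ecard_image: "inj_on f A \<Longrightarrow> ecard (f ` A) = ecard A"
  by (simp add: ecard_def card_image finite_image_iff)

text \<open>To be used with the lamination as \<open>A\<close> and the segment as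
  \<open>B\<close>.\<close>

lemma ecard_image_Int:
  assumes "bij h"
  shows "ecard (h ` A \<inter> B) = ecard (inverse_map h ` B \<inter> A)"
proof -
  have "h ` A \<inter> B = h ` (inverse_map h ` B \<inter> A)"
    using assms by (simp add: image_Int bij_is_inj bij_is_surj image_f_inv_f Int_commute)
  then show ?thesis
    by (metis assms bij_is_inj ecard_image inj_on_subset top_greatest)
qed

theorem proposition3p1:
  fixes n :: nat and p :: "nat \<Rightarrow> real" and \<beta> :: "(complex \<Rightarrow> complex) set"
  assumes "n \<ge> 1"
    and "strict_mono_on {1..n} p"
    and "\<forall>j\<in>{1..n}. -1 < p j \<and> p j < 1"
    and "\<beta> \<in> carrier (braid_group n p)"
  shows "laminated_norm n p \<beta> = diagrammatic_norm n p (inv\<^bsub>braid_group n p\<^esub> \<beta>)"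
proof -
  have "bij h" if "h \<in> \<beta>" for h
    using that assms(4) by (auto simp: carrier_braid_group isotopy_rel_def dest: braid_homeosD)
  then show ?thesis
    \<comment> \<open>After \<open>image_image\<close> both infima range over
      \<open>\<beta>\<close>, and they agree term by term.\<close>
    unfolding laminated_norm_def diagrammatic_norm_def inv_braid_group[OF assms(4)] image_image
    by (intro INF_cong refl ecard_image_Int)
qed

end
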